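(* For all $w_1,w_2\in\mathbb{N}$ and all integers $n\geq 0$, the following identity holds (as polynomials in $x$): $$\sum_{i=0}^{w_1-1}B_n\!\left(w_2x+\frac{w_2}{w_1}i\right)w_1^{n-1}=\sum_{i=0}^{w_2-1}B_n\!\left(w_1x+\frac{w_1}{w_2}i\right)w_2^{n-1}.$$
   Context: $\mathbb{N}$ denotes the positive integers. $B_n(x)$ are the ordinary Bernoulli polynomials, $\frac{te^{xt}}{e^t-1}=\sum_{n\ge0}B_n(x)\frac{t^n}{n!}$. *)

theory Defs
  imports "HOL-Computational_Algebra.Computational_Algebra"
begin

text \<open>
  The series \<open>t e^(xt) / (e^t - 1)\<close> with coefficients in the polynomials in \<open>x\<close>. Division of
  formal power series is only available over a field, so \<open>t / (e^t - 1)\<close> is formed over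
  the field of constants, and its coefficients are then embedded as constant polynomials.
  The second factor is \<open>e^(xt)\<close>, whose \<open>k\<close>-th coefficient is \<open>x^k / k!\<close>.
\<close>

definition bernoulli_gf :: "'a :: field_char_0 poly fps" where
  "bernoulli_gf =
     Abs_fps (\<lambda>k. [:fps_nth (fps_X / (fps_exp 1 - 1)) k:]) * Abs_fps (\<lambda>k. monom (1 / fact k) k)"

definition bernoulli_poly :: "nat \<Rightarrow> 'a :: field_char_0 poly" where
  "bernoulli_poly n = smult (fact n) (fps_nth bernoulli_gf n)"

lemma poly_bernoulli_gf:
  "Abs_fps (\<lambda>n. poly (fps_nth bernoulli_gf n) x) = fps_X / (fps_exp 1 - 1) * fps_exp x"
  by (rule fps_ext)
     (simp add: bernoulli_gf_def fps_mult_nth poly_sum poly_monom)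

lemma fps_exp_minus_1_mult_quotient:
  "(fps_exp 1 - 1) * (fps_X / (fps_exp 1 - 1)) = (fps_X :: 'a :: field_char_0 fps)"
proof -
  let ?d = "fps_exp 1 - 1 :: 'a fps"
  have nz: "fps_nth ?d 1 \<noteq> 0" "fps_nth ?d 0 = 0" by simp_all
  hence "subdegree ?d = 1"
    by (intro subdegreeI) auto
  moreover have "?d \<noteq> 0" using nz by auto
  ultimately have "?d dvd fps_X"
    by (simp add: fps_dvd_iff)
  thus ?thesis by simp
qed

lemma bernoulli_poly_generating_function:
  "(fps_exp 1 - 1) * Abs_fps (\<lambda>n. poly (bernoulli_poly n) x / fact n)
     = fps_X * fps_exp (x :: 'a :: field_char_0)"
proof -
  have "Abs_fps (\<lambda>n. poly (bernoulli_poly n) x / fact n)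
          = fps_X / (fps_exp 1 - 1) * fps_exp x"
    by (simp add: bernoulli_poly_def flip: poly_bernoulli_gf)
  thus ?thesis
    by (metis fps_exp_minus_1_mult_quotient mult.assoc)
qed

end

theory Submission
  imports Defs
begin

text \<open>
  With \<open>S n\<close> one side of the identity at the point \<open>x\<close>, the series \<open>\<Sum>n. S n t^n / n!\<close> is a sum of
  rescaled Bernoulli generating functions, whose exponentials form a geometric progression. It
  equals \<open>t e^(w1 w2 x t) (e^(w1 w2 t) - 1) / ((e^(w1 t) - 1) (e^(w2 t) - 1))\<close>,
  which is symmetric in \<open>w1\<close> and \<open>w2\<close>.
\<close>

text \<open>Substitute \<open>c * t\<close> for \<open>t\<close> in the generating function:
  composition with \<open>fps_const c * fps_X\<close> multiplies the \<open>n\<close>-th coefficient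
  by \<open>c ^ n\<close>.\<close>

lemma bernoulli_poly_generating_function_scaled:
  fixes c x :: "'a :: field_char_0"
  shows "(fps_exp c - 1) * Abs_fps (\<lambda>n. c ^ n * poly (bernoulli_poly n) x / fact n)
           = fps_const c * fps_X * fps_exp (c * x)"
proof -
  let ?s = "fps_const c * fps_X"
  have "((fps_exp 1 - 1) * Abs_fps (\<lambda>n. poly (bernoulli_poly n) x / fact n)) oo ?s
          = (fps_X * fps_exp x) oo ?s"
    by (simp only: bernoulli_poly_generating_function)
  moreover have "Abs_fps (\<lambda>n. poly (bernoulli_poly n) x / fact n) oo ?s
      = Abs_fps (\<lambda>n. c ^ n * poly (bernoulli_poly n) x / fact n)"
    by (simp add: fps_compose_linear)
  ultimately show ?thesis
    by (simp add: fps_compose_mult_distrib fps_compose_sub_distrib mult.commute[of x])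
qed

lemma fps_exp_minus_1_mult_geometric_sum:
  fixes b :: "'a :: field_char_0"
  shows "(fps_exp b - 1) * (\<Sum>i<m. fps_exp (of_nat i * b)) = fps_exp (of_nat m * b) - 1"
  by (simp add: power_diff_1_eq flip: fps_exp_power_mult)

text \<open>Both denominators are kept as factors on the left, since their constant terms vanish and
  they are not units. The right side is symmetric in \<open>of_nat m\<close> and
  \<open>b\<close>.\<close>

lemma bernoulli_sum_generating_function:
  fixes b x :: "'a :: field_char_0"
  assumes "m > 0"
  shows "(fps_exp (of_nat m) - 1) * (fps_exp b - 1) *
           Abs_fps (\<lambda>n. (\<Sum>i<m. of_nat m powi (int n - 1) *
             poly (bernoulli_poly n) (b * x + b / of_nat m * of_nat i)) / fact n)
         = fps_X * fps_exp (of_nat m * b * x) * (fps_exp (of_nat m * b) - 1)"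
proof -
  define a where "a = (of_nat m :: 'a)"
  have a: "a \<noteq> 0"
    using assms by (simp add: a_def)
  define y where "y i = b * x + b / a * of_nat i" for i
  \<comment> \<open>Writing \<open>a powi (int n - 1)\<close> as \<open>a ^ n / a\<close> also
    covers \<open>n = 0\<close>, where the exponent is -1.\<close>
  have "Abs_fps (\<lambda>n. (\<Sum>i<m. a powi (int n - 1) * poly (bernoulli_poly n) (y i)) / fact n)
      = fps_const (1 / a) *
          (\<Sum>i<m. Abs_fps (\<lambda>n. a ^ n * poly (bernoulli_poly n) (y i) / fact n))"
    using a by (intro fps_ext)
      (simp add: fps_sum_nth power_int_diff sum_divide_distrib sum_distrib_left mult_ac)
  \<comment> \<open>Scaling by \<open>a\<close> turns the shift \<open>b / a * of_nat i\<close> into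
    \<open>of_nat i * b\<close>, so the exponentials have common ratio
    \<open>fps_exp b\<close>.\<close>
  moreover have "fps_exp (a * y i) = fps_exp (a * b * x) * fps_exp (of_nat i * b)" for i
    using a by (simp add: y_def algebra_simps flip: fps_exp_add_mult)
  then have "(fps_exp a - 1) *
      (\<Sum>i<m. Abs_fps (\<lambda>n. a ^ n * poly (bernoulli_poly n) (y i) / fact n))
      = fps_const a * fps_X * fps_exp (a * b * x) * (\<Sum>i<m. fps_exp (of_nat i * b))"
    by (simp only: sum_distrib_left bernoulli_poly_generating_function_scaled mult.assoc)
  ultimately have "(fps_exp a - 1) *
      Abs_fps (\<lambda>n. (\<Sum>i<m. a powi (int n - 1) * poly (bernoulli_poly n) (y i)) / fact n)
      = fps_const (1 / a) * (fps_const a * fps_X * fps_exp (a * b * x)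
          * (\<Sum>i<m. fps_exp (of_nat i * b)))"
    by (simp only: mult.left_commute[of _ "fps_const (1 / a)"])
  also have "\<dots> = (fps_const (1 / a) * fps_const a) * (fps_X * fps_exp (a * b * x)
          * (\<Sum>i<m. fps_exp (of_nat i * b)))"
    by (simp only: mult.assoc)
  also have "fps_const (1 / a) * fps_const a = 1"
    using a by simp
  finally show ?thesis
    using fps_exp_minus_1_mult_geometric_sum[of b m]
    unfolding a_def[symmetric] y_def by (simp only: mult_1_left) algebra
qed

theorem corollary4:
  fixes w1 w2 n :: nat
  assumes "w1 > 0" and "w2 > 0"
  shows "(\<Sum>i=0..w1-1.
            smult (of_nat w1 powi (int n - 1))
              (pcompose (bernoulli_poly n) [:of_nat w2 / of_nat w1 * of_nat i, of_nat w2:]))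
         = (\<Sum>i=0..w2-1.
            smult (of_nat w2 powi (int n - 1))
              (pcompose (bernoulli_poly n) [:of_nat w1 / of_nat w2 * of_nat i, of_nat w1:])
              :: 'a :: field_char_0 poly)"
proof -
  \<comment> \<open>Subtraction on \<open>nat\<close> truncates: at \<open>w = 0\<close> the left
    set would be \<open>{0}\<close>, hence the positivity condition.\<close>
  have range: "{0..w - Suc 0} = {..<w}" if "w > 0" for w :: nat
    using that by auto
  define S where "S v w x k = (\<Sum>i<v. of_nat v powi (int k - 1) *
      poly (bernoulli_poly k) (of_nat w * x + of_nat w / of_nat v * of_nat i))"
    for v w k and x :: 'a
  have "S w1 w2 x n = S w2 w1 x n" for x
  proof -
    let ?D = "(fps_exp (of_nat w1) - 1) * (fps_exp (of_nat w2) - 1) :: 'a fps"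
    have "?D * Abs_fps (\<lambda>k. S w1 w2 x k / fact k) = ?D * Abs_fps (\<lambda>k. S w2 w1 x k / fact k)"
      using bernoulli_sum_generating_function[OF assms(1), of "of_nat w2" x]
        bernoulli_sum_generating_function[OF assms(2), of "of_nat w1" x]
      by (simp add: S_def mult_ac)
    \<comment> \<open>Power series over a field form an integral domain, so a nonzero
      \<open>?D\<close> can be cancelled although it is not invertible.\<close>
    moreover have "?D \<noteq> 0"
      using assms by simp
    ultimately have "Abs_fps (\<lambda>k. S w1 w2 x k / fact k) = Abs_fps (\<lambda>k. S w2 w1 x k / fact k)"
      by (metis mult_left_cancel)
    from arg_cong[OF this, of "\<lambda>f. fps_nth f n"] show ?thesis
      by simp
  qed
  thus ?thesis
    \<comment> \<open>In characteristic 0 the field is infinite, so agreement at every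
      \<open>x\<close> gives equality of polynomials.\<close>
    by (intro poly_eq_poly_eq_iff[THEN iffD1] ext)
      (simp add: assms range S_def poly_sum poly_pcompose algebra_simps)
qed

end
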